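(* Let $P$ be a poset with inconsistent pairs (PIP). The following three topological spaces are homotopy equivalent: (1) the (geometric realisation of the) crossing complex $\Delta_P$; (2) the union of the hyperplanes of $\square_P$, as a subspace of $\|\square_P\|$; (3) the space $\|\square_P\|$ with all vertices removed, i.e. $\|\square_P\| \setminus \|V(\square_P)\|$.
   Context: A poset with inconsistent pairs (PIP) is a triple $(P,\le,\nleftrightarrow)$ where $(P,\le)$ is a finite poset and $\nleftrightarrow$ is an irreflexive symmetric relation on $P$ such that $a \nleftrightarrow b$, $a \le a'$, $b \le b'$ imply $a' \nleftrightarrow b'$. A subset is consistent if it contains no pair $a \nleftrightarrow b$. A downset is a subset closed under going down in $\le$; $\max I$ is the set of maximal elements of $I$. The cubical complex $\square_P$ has as vertices the consistent downsets of $P$, and has a face $C(I,M) := \{\, I \setminus N : N \subseteq M \,\}$ of dimension $|M|$ for each pair $(I,M)$ with $I$ a consistent downset and $M \subseteq \max I$. It is a $\mathrm{CAT}(0)$ cubical complex. Its geometric realisation $\|\square_P\|$ is obtained by gluing cubes $[0,1]^{|M|}$, one for each face, along corresponding faces; equivalently it is the union of the corresponding faces of the cube $[0,1]^P$, where a downset $I$ is identified with its indicator vector. $V(\square_P)$ is the set of vertices, and $\|V(\square_P)\|$ the corresponding set of points. The crossing complex $\Delta_P$ is the simplicial complex with vertex set $P$ whose faces are the consistent antichains of $P$. For a cube $[0,1]^i$, a midplane is a subset in which one coordinate is fixed to be $\tfrac12$. Two midplanes in a cubical complex are adjacent if their intersection is a midplane of another cube; a hyperplane is the union of the midplanes in an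 equivalence class of the transitive closure of adjacency. *)

theory Defs
  imports "HOL-Analysis.Analysis"
begin

definition pip :: "'a set \<Rightarrow> 'a rel \<Rightarrow> 'a rel \<Rightarrow> bool" where
  "pip P r inc \<longleftrightarrow>
     finite P \<and> partial_order_on P r \<and>
     inc \<subseteq> P \<times> P \<and> irrefl inc \<and> sym inc \<and>
     (\<forall>a b a' b'. (a, b) \<in> inc \<longrightarrow> (a, a') \<in> r \<longrightarrow> (b, b') \<in> r \<longrightarrow> (a', b') \<in> inc)"

definition consistent :: "'a rel \<Rightarrow> 'a set \<Rightarrow> bool" where
  "consistent inc S \<longleftrightarrow> (\<forall>a\<in>S. \<forall>b\<in>S. (a, b) \<notin> inc)"

definition downset :: "'a set \<Rightarrow> 'a rel \<Rightarrow> 'a set \<Rightarrow> bool" where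
  "downset P r I \<longleftrightarrow> I \<subseteq> P \<and> (\<forall>x\<in>I. \<forall>y\<in>P. (y, x) \<in> r \<longrightarrow> y \<in> I)"

definition antichain :: "'a set \<Rightarrow> 'a rel \<Rightarrow> 'a set \<Rightarrow> bool" where
  "antichain P r A \<longleftrightarrow> A \<subseteq> P \<and> (\<forall>x\<in>A. \<forall>y\<in>A. (x, y) \<in> r \<longrightarrow> x = y)"

definition max_elems :: "'a rel \<Rightarrow> 'a set \<Rightarrow> 'a set" where
  "max_elems r I = {m \<in> I. \<forall>x\<in>I. (m, x) \<in> r \<longrightarrow> x = m}"


section \<open>The crossing complex\<close>

definition crossing_complex :: "'a set \<Rightarrow> 'a rel \<Rightarrow> 'a rel \<Rightarrow> 'a set set" where
  "crossing_complex P r inc = {A. antichain P r A \<and> consistent inc A}"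

text \<open>The geometric realisation, in barycentric coordinates, of an abstract simplicial complex
  \<open>K\<close> with finite vertex set \<open>V\<close>. The empty simplex, which belongs to \<open>K\<close>,
  contributes no points because coordinates sum to 1.\<close>

definition simplicial_realisation :: "'a set \<Rightarrow> 'a set set \<Rightarrow> ('a \<Rightarrow> real) set" where
  "simplicial_realisation V K =
     {x \<in> V \<rightarrow>\<^sub>E {0..}. (\<Sum>v\<in>V. x v) = 1 \<and> {v \<in> V. x v \<noteq> 0} \<in> K}"

definition simplicial_space :: "'a set \<Rightarrow> 'a set set \<Rightarrow> ('a \<Rightarrow> real) topology" where
  "simplicial_space V K = subtopology (powertop_real V) (simplicial_realisation V K)"


section \<open>The cubical complex\<close>

definition cubical_vertices :: "'a set \<Rightarrow> 'a rel \<Rightarrow> 'a rel \<Rightarrow> 'a set set" where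
  "cubical_vertices P r inc = {I. downset P r I \<and> consistent inc I}"

text \<open>The pairs \<open>(I, M)\<close> indexing the faces, and the vertex set of the face with index
  \<open>(I, M)\<close>.\<close>

definition cubical_faces :: "'a set \<Rightarrow> 'a rel \<Rightarrow> 'a rel \<Rightarrow> ('a set \<times> 'a set) set" where
  "cubical_faces P r inc = {(I, M). I \<in> cubical_vertices P r inc \<and> M \<subseteq> max_elems r I}"

definition cube_vertices :: "'a set \<Rightarrow> 'a set \<Rightarrow> 'a set set" where
  "cube_vertices I M = {I - N | N. N \<subseteq> M}"

text \<open>Everything lives in the cube \<open>[0,1]^P\<close>, represented by extensional functions on
  \<open>P\<close>. A set \<open>I \<subseteq> P\<close> corresponds to the point \<open>vertex_point P I\<close>, and
  the face with index \<open>(I, M)\<close> to the face \<open>cube P I M\<close> of \<open>[0,1]^P\<close> spanned by the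
  points of its vertices: the coordinates in \<open>M\<close> are free, the others are those of
  \<open>vertex_point P I\<close>.\<close>

definition vertex_point :: "'a set \<Rightarrow> 'a set \<Rightarrow> 'a \<Rightarrow> real" where
  "vertex_point P I = restrict (indicator I) P"

definition cube :: "'a set \<Rightarrow> 'a set \<Rightarrow> 'a set \<Rightarrow> ('a \<Rightarrow> real) set" where
  "cube P I M = {x \<in> P \<rightarrow>\<^sub>E {0..1}. \<forall>p\<in>P - M. x p = vertex_point P I p}"

lemma vertex_points_in_cube:
  assumes "I \<subseteq> P" "M \<subseteq> I" "J \<subseteq> P"
  shows "vertex_point P J \<in> cube P I M \<longleftrightarrow> J \<in> cube_vertices I M"
proof
  assume "vertex_point P J \<in> cube P I M"
  then have *: "(p \<in> J) = (p \<in> I)" if "p \<in> P - M" for p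
    using that by (auto simp: cube_def vertex_point_def indicator_def of_bool_def split: if_splits)
  have "J = I - (M - J)"
    using * assms by blast
  then show "J \<in> cube_vertices I M"
    unfolding cube_vertices_def by blast
next
  assume "J \<in> cube_vertices I M"
  then show "vertex_point P J \<in> cube P I M"
    by (auto simp: cube_def cube_vertices_def vertex_point_def indicator_def)
qed

definition cubical_realisation :: "'a set \<Rightarrow> 'a rel \<Rightarrow> 'a rel \<Rightarrow> ('a \<Rightarrow> real) set" where
  "cubical_realisation P r inc = (\<Union>(I, M)\<in>cubical_faces P r inc. cube P I M)"

definition cubical_space :: "'a set \<Rightarrow> 'a rel \<Rightarrow> 'a rel \<Rightarrow> ('a \<Rightarrow> real) topology" where
  "cubical_space P r inc = subtopology (powertop_real P) (cubical_realisation P r inc)"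


section \<open>Hyperplanes\<close>

definition midplanes :: "'a set \<Rightarrow> 'a rel \<Rightarrow> 'a rel \<Rightarrow> ('a \<Rightarrow> real) set set" where
  "midplanes P r inc =
     {{x \<in> cube P I M. x p = 1/2} | I M p. (I, M) \<in> cubical_faces P r inc \<and> p \<in> M}"

text \<open>The cube of which the intersection is a midplane may be one of the two given ones: thus the
  midpoint of an edge of a square is adjacent to the midplane of the square through it.
  In particular, every midplane is adjacent to itself.\<close>

definition midplane_adj ::
  "'a set \<Rightarrow> 'a rel \<Rightarrow> 'a rel \<Rightarrow> ('a \<Rightarrow> real) set rel" where
  "midplane_adj P r inc =
     {(m, m'). m \<in> midplanes P r inc \<and> m' \<in> midplanes P r inc \<and> m \<inter> m' \<in> midplanes P r inc}"

lemma equiv_midplane_adj: "equiv (midplanes P r inc) ((midplane_adj P r inc)\<^sup>+)"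
proof (rule equivI)
  have "midplane_adj P r inc \<subseteq> midplanes P r inc \<times> midplanes P r inc"
    by (auto simp: midplane_adj_def)
  then show "(midplane_adj P r inc)\<^sup>+ \<subseteq> midplanes P r inc \<times> midplanes P r inc"
    by (rule trancl_subset_Sigma)
  show "refl_on (midplanes P r inc) ((midplane_adj P r inc)\<^sup>+)"
    by (auto simp: refl_on_def midplane_adj_def intro!: r_into_trancl)
  show "sym ((midplane_adj P r inc)\<^sup>+)"
    by (rule sym_trancl) (auto simp: sym_def midplane_adj_def Int_commute)
qed (rule trans_trancl)

definition hyperplanes :: "'a set \<Rightarrow> 'a rel \<Rightarrow> 'a rel \<Rightarrow> ('a \<Rightarrow> real) set set" where
  "hyperplanes P r inc = Union ` (midplanes P r inc // (midplane_adj P r inc)\<^sup>+)"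

end

theory Submission
  imports Defs
begin

text \<open>A point \<open>x\<close> of \<open>[0,1]^P\<close> lies in the cubical complex iff its support is consistent and
  \<open>x p = 1\<close> whenever \<open>p < q\<close> and \<open>x q > 0\<close>. So the coordinates of \<open>x\<close> strictly between 0 and 1
  form a consistent antichain, and if there are any, normalising \<open>x p * (1 - x p)\<close> gives a point
  \<open>to_\<Delta> x\<close> of the crossing complex. In the other direction, \<open>to_\<K> y\<close> vanishes outside the downset
  generated by the support of \<open>y\<close>, and is fractional where \<open>y\<close> is large. It equals 1/2 where
  \<open>y\<close> is at least the average \<open>1 / card P\<close>, so \<open>to_\<K> y\<close> even lies on a hyperplane.

  Both \<open>to_\<Delta> (to_\<K> y)\<close> and \<open>y\<close> are joined by segments to the point obtained from the large
  coordinates of \<open>y\<close> alone. With \<open>x' = to_\<K> (to_\<Delta> x)\<close>, the points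
  \<open>max x' (min x (card P * t - height))\<close> move \<open>x'\<close> to \<open>max x' x\<close>, adding the rest of \<open>x\<close> in order
  of increasing height, and a segment leads on to \<open>x\<close>. On the way, a coordinate of \<open>x\<close>
  closest to 1/2 never moves away from 1/2, since \<open>x'\<close> is 1/2 there. Hence the same homotopies
  serve for the union of the hyperplanes and for the complement of the vertices.\<close>

section \<open>Homotopies between maps into coordinate space\<close>

text \<open>Continuity into a product is a matter of single coordinates, and landing in
  \<open>A\<close> is a pointwise condition. \<open>restrict\<close> supplies the extensional
  functions that make up the product.\<close>

lemma homotopic_with_componentwise:
  fixes h :: "real \<Rightarrow> 'b \<Rightarrow> 'a \<Rightarrow> real"
  assumes cont: "\<And>p. p \<in> P \<Longrightarrow>
      continuous_map (prod_topology (top_of_set {0..1}) X) euclideanreal (\<lambda>z. h (fst z) (snd z) p)"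
    and mem: "\<And>t x. \<lbrakk>x \<in> topspace X; 0 \<le> t; t \<le> 1\<rbrakk> \<Longrightarrow> restrict (h t x) P \<in> A"
    and h0: "\<And>x. x \<in> topspace X \<Longrightarrow> restrict (h 0 x) P = f x"
    and h1: "\<And>x. x \<in> topspace X \<Longrightarrow> restrict (h 1 x) P = g x"
  shows "homotopic_with (\<lambda>_. True) X (subtopology (powertop_real P) A) f g"
proof -
  let ?h = "\<lambda>z. restrict (h (fst z) (snd z)) P"
  have "continuous_map (prod_topology (top_of_set {0..1}) X) (powertop_real P) ?h"
    using cont by (auto simp: continuous_map_componentwise)
  then have "continuous_map (prod_topology (top_of_set {0..1}) X)
               (subtopology (powertop_real P) A) ?h"
    by (rule continuous_map_into_subtopology) (auto simp: mem)
  then show ?thesis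
    by (subst homotopic_with) (auto simp: h0 h1 intro!: exI[of _ ?h])
qed

lemma continuous_map_snd_coordinate:
  assumes "continuous_map X (powertop_real P) f" and "p \<in> P"
  shows "continuous_map (prod_topology T X) euclideanreal (\<lambda>z. f (snd z) p)"
proof -
  have "continuous_map X euclideanreal (\<lambda>x. f x p)"
    using assms by (simp add: continuous_map_componentwise)
  from continuous_map_compose[OF continuous_map_snd this] show ?thesis by (simp add: o_def)
qed

lemma continuous_map_fst_real:
  "continuous_map (prod_topology (top_of_set S) X) euclideanreal (fst :: real \<times> _ \<Rightarrow> _)"
  by (rule continuous_map_into_fulltopology[OF continuous_map_fst])

lemma homotopic_with_segments:
  assumes f: "continuous_map X (powertop_real P) f" and g: "continuous_map X (powertop_real P) g"
    and mem: "\<And>t x. \<lbrakk>x \<in> topspace X; 0 \<le> t; t \<le> 1\<rbrakk> \<Longrightarrow>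
                (\<lambda>p\<in>P. (1 - t) * f x p + t * g x p) \<in> A"
  shows "homotopic_with (\<lambda>_. True) X (subtopology (powertop_real P) A) f g"
proof (rule homotopic_with_componentwise[where h = "\<lambda>t x p. (1 - t) * f x p + t * g x p"])
  fix p assume p: "p \<in> P"
  show "continuous_map (prod_topology (top_of_set {0..1}) X) euclideanreal
      (\<lambda>z. (1 - fst z) * f (snd z) p + fst z * g (snd z) p)"
    by (intro continuous_intros continuous_map_fst_real continuous_map_snd_coordinate[OF _ p] f g)
next
  fix x assume "x \<in> topspace X"
  then have "f x \<in> extensional P" "g x \<in> extensional P"
    using f g by (auto simp: continuous_map_componentwise)
  then show "(\<lambda>p\<in>P. (1 - 0) * f x p + 0 * g x p) = f x"
    "(\<lambda>p\<in>P. (1 - 1) * f x p + 1 * g x p) = g x"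
    by (auto simp: extensional_def fun_eq_iff)
qed (rule mem)


section \<open>Points of the two realisations\<close>

locale inconsistent_pairs =
  fixes P :: "'a set" and r inc :: "'a rel"
  assumes pip: "pip P r inc"
begin

lemma finite_P: "finite P"
  and r_refl: "p \<in> P \<Longrightarrow> (p, p) \<in> r"
  and r_trans: "(p, q) \<in> r \<Longrightarrow> (q, s) \<in> r \<Longrightarrow> (p, s) \<in> r"
  and r_antisym: "(p, q) \<in> r \<Longrightarrow> (q, p) \<in> r \<Longrightarrow> p = q"
  and r_sub: "(p, q) \<in> r \<Longrightarrow> p \<in> P \<and> q \<in> P"
  and inc_up: "(a, b) \<in> inc \<Longrightarrow> (a, a') \<in> r \<Longrightarrow> (b, b') \<in> r \<Longrightarrow> (a', b') \<in> inc"
proof -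
  show "finite P" using pip by (simp add: pip_def)
  have po: "partial_order_on P r" and up: "\<forall>a b a' b'. (a, b) \<in> inc \<longrightarrow> (a, a') \<in> r \<longrightarrow>
      (b, b') \<in> r \<longrightarrow> (a', b') \<in> inc"
    using pip unfolding pip_def by blast+
  note po = partial_order_onD[OF po]
  show "p \<in> P \<Longrightarrow> (p, p) \<in> r" using po(1) by (rule refl_onD)
  show "(p, q) \<in> r \<Longrightarrow> (q, s) \<in> r \<Longrightarrow> (p, s) \<in> r" using po(2) by (rule transD)
  show "(p, q) \<in> r \<Longrightarrow> (q, p) \<in> r \<Longrightarrow> p = q" using po(3) by (rule antisymD)
  show "(p, q) \<in> r \<Longrightarrow> p \<in> P \<and> q \<in> P" using po(4) by blast
  show "(a, b) \<in> inc \<Longrightarrow> (a, a') \<in> r \<Longrightarrow> (b, b') \<in> r \<Longrightarrow> (a', b') \<in> inc" using up by blast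
qed

abbreviation "\<Delta> \<equiv> simplicial_realisation P (crossing_complex P r inc)"
abbreviation "\<K> \<equiv> cubical_realisation P r inc"

lemma mem_\<Delta>_iff:
  "y \<in> \<Delta> \<longleftrightarrow> y \<in> P \<rightarrow>\<^sub>E {0..} \<and> (\<Sum>p\<in>P. y p) = 1 \<and>
     (\<forall>p\<in>P. \<forall>q\<in>P. y p \<noteq> 0 \<longrightarrow> y q \<noteq> 0 \<longrightarrow> (p, q) \<notin> inc \<and> ((p, q) \<in> r \<longrightarrow> p = q))"
  unfolding simplicial_realisation_def crossing_complex_def antichain_def consistent_def
  by auto

text \<open>A face \<open>(I, M)\<close> leaves only coordinates at maximal elements of
  \<open>I\<close> free, so whatever lies strictly below an element of \<open>I\<close> has
  coordinate 1. Conversely, \<open>x\<close> lies in the face whose \<open>I\<close> is the support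
  of \<open>x\<close> and whose \<open>M\<close> is the set of its fractional coordinates.\<close>

lemma mem_\<K>_iff:
  "x \<in> \<K> \<longleftrightarrow> x \<in> P \<rightarrow>\<^sub>E {0..1} \<and>
     (\<forall>p\<in>P. \<forall>q\<in>P. 0 < x q \<longrightarrow> (p, q) \<in> r \<longrightarrow> p \<noteq> q \<longrightarrow> x p = 1) \<and>
     (\<forall>p\<in>P. \<forall>q\<in>P. 0 < x p \<longrightarrow> 0 < x q \<longrightarrow> (p, q) \<notin> inc)" (is "_ \<longleftrightarrow> ?R")
proof
  assume "x \<in> \<K>"
  then obtain I M where I: "downset P r I" "consistent inc I" and M: "M \<subseteq> max_elems r I"
    and x: "x \<in> cube P I M"
    by (auto simp: cubical_realisation_def cubical_faces_def cubical_vertices_def)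
  have out: "x p = (if p \<in> I then 1 else 0)" if "p \<in> P" "p \<notin> M" for p
    using x that by (auto simp: cube_def vertex_point_def indicator_def)
  have pos: "p \<in> I" if "p \<in> P" "0 < x p" for p
    using out[OF that(1)] that M by (cases \<open>p \<in> M\<close>) (auto simp: max_elems_def split: if_splits)
  have "x p = 1" if "p \<in> P" "q \<in> P" "0 < x q" "(p, q) \<in> r" "p \<noteq> q" for p q
  proof -
    have "q \<in> I" "p \<in> I" using pos that I(1) by (auto simp: downset_def)
    moreover have "p \<notin> M" using M that \<open>q \<in> I\<close> by (auto simp: max_elems_def)
    ultimately show ?thesis using out that by auto
  qed
  moreover have "(p, q) \<notin> inc" if "p \<in> P" "q \<in> P" "0 < x p" "0 < x q" for p q
    using pos that I(2) by (auto simp: consistent_def)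
  moreover have "x \<in> P \<rightarrow>\<^sub>E {0..1}" using x by (simp add: cube_def)
  ultimately show ?R by blast
next
  assume R: ?R
  let ?I = "{p \<in> P. 0 < x p}" and ?M = "{p \<in> P. 0 < x p \<and> x p < 1}"
  have "y \<in> ?I" if "p \<in> ?I" "y \<in> P" "(y, p) \<in> r" for p y
    using R that by (cases "y = p") auto
  then have "downset P r ?I" unfolding downset_def by blast
  moreover have "consistent inc ?I" using R by (auto simp: consistent_def)
  \<comment> \<open>An element of the support strictly above a fractional \<open>p\<close> would
    force \<open>x p = 1\<close>.\<close>
  moreover have "q = p" if "p \<in> ?M" "q \<in> ?I" "(p, q) \<in> r" for p q
    using R that by fastforce
  then have "?M \<subseteq> max_elems r ?I" by (auto simp: max_elems_def)
  moreover have "x p = vertex_point P ?I p" if "p \<in> P - ?M" for p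
  proof -
    have "0 \<le> x p" "x p \<le> 1" using R that by (auto simp: PiE_iff)
    then show ?thesis using that by (auto simp: vertex_point_def indicator_def)
  qed
  then have "x \<in> cube P ?I ?M"
    using R by (simp add: cube_def)
  ultimately have "(?I, ?M) \<in> cubical_faces P r inc" "x \<in> cube P ?I ?M"
    by (simp_all add: cubical_faces_def cubical_vertices_def)
  then show "x \<in> \<K>"
    unfolding cubical_realisation_def by (intro UN_I[of "(?I, ?M)"]) simp_all
qed

lemma \<K>_bounds: "x \<in> \<K> \<Longrightarrow> p \<in> P \<Longrightarrow> 0 \<le> x p \<and> x p \<le> 1"
  using PiE_mem[of x P "\<lambda>_. {0..1}" p] unfolding mem_\<K>_iff atLeastAtMost_iff by blast

lemma \<K>_below: "x \<in> \<K> \<Longrightarrow> 0 < x q \<Longrightarrow> (p, q) \<in> r \<Longrightarrow> p \<noteq> q \<Longrightarrow> x p = 1"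
  using r_sub unfolding mem_\<K>_iff by blast

lemma \<K>_consistent: "x \<in> \<K> \<Longrightarrow> p \<in> P \<Longrightarrow> q \<in> P \<Longrightarrow> 0 < x p \<Longrightarrow> 0 < x q \<Longrightarrow> (p, q) \<notin> inc"
  unfolding mem_\<K>_iff by blast

lemma \<K>_extensional: "x \<in> \<K> \<Longrightarrow> x \<in> extensional P"
  unfolding mem_\<K>_iff PiE_iff by blast

lemma \<Delta>_antichain: "y \<in> \<Delta> \<Longrightarrow> (p, q) \<in> r \<Longrightarrow> y p \<noteq> 0 \<Longrightarrow> y q \<noteq> 0 \<Longrightarrow> p = q"
  using r_sub by (auto simp: mem_\<Delta>_iff)

lemma \<Delta>_consistent: "y \<in> \<Delta> \<Longrightarrow> p \<in> P \<Longrightarrow> q \<in> P \<Longrightarrow> y p \<noteq> 0 \<Longrightarrow> y q \<noteq> 0 \<Longrightarrow> (p, q) \<notin> inc"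
  by (auto simp: mem_\<Delta>_iff)

text \<open>The coordinates sum to 1, so they cannot all be below their average.\<close>

lemma \<Delta>_large_coordinate:
  assumes "y \<in> \<Delta>"
  obtains p where "p \<in> P" "1 / card P \<le> y p"
proof -
  have "\<exists>p\<in>P. 1 / card P \<le> y p"
  proof (rule ccontr)
    assume "\<not> ?thesis"
    moreover have "P \<noteq> {}" using assms by (auto simp: mem_\<Delta>_iff)
    ultimately have "(\<Sum>p\<in>P. y p) < (\<Sum>p\<in>P. 1 / card P)"
      using finite_P by (intro sum_strict_mono) auto
    also have "\<dots> = 1" using \<open>P \<noteq> {}\<close> finite_P by simp
    finally show False using assms by (simp add: mem_\<Delta>_iff)
  qed
  then show thesis using that by blast
qed

text \<open>Every point of the segment has its support inside that of \<open>z\<close>, hence stays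
  in one simplex. Both directions are stated because later segments run towards as well as away from
  the end with the smaller support.\<close>

lemma \<Delta>_segment:
  assumes y: "y \<in> \<Delta>" and z: "z \<in> \<Delta>" and t: "0 \<le> t" "t \<le> 1"
    and supp: "\<And>p. p \<in> P \<Longrightarrow> y p \<noteq> 0 \<Longrightarrow> z p \<noteq> 0"
  shows "(\<lambda>p\<in>P. (1 - t) * y p + t * z p) \<in> \<Delta>" "(\<lambda>p\<in>P. (1 - t) * z p + t * y p) \<in> \<Delta>"
proof -
  have *: "(\<lambda>p\<in>P. a * y p + b * z p) \<in> \<Delta>" if "0 \<le> a" "0 \<le> b" "a + b = 1" for a b
  proof -
    have "z p \<noteq> 0" if "p \<in> P" "a * y p + b * z p \<noteq> 0" for p
      using that supp by auto
    then show ?thesis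
      using y z that unfolding mem_\<Delta>_iff
      by (auto simp: sum.distrib simp flip: sum_distrib_left intro!: add_nonneg_nonneg mult_nonneg_nonneg)
  qed
  show "(\<lambda>p\<in>P. (1 - t) * y p + t * z p) \<in> \<Delta>" using *[of "1 - t" t] t by simp
  show "(\<lambda>p\<in>P. (1 - t) * z p + t * y p) \<in> \<Delta>" using *[of t "1 - t"] t by (simp add: add.commute)
qed

section \<open>Normalising nonnegative weights to barycentric coordinates\<close>

definition normalise :: "('a \<Rightarrow> real) \<Rightarrow> 'a \<Rightarrow> real" where
  "normalise w = (\<lambda>p\<in>P. w p / (\<Sum>q\<in>P. w q))"

lemma normalise_in_\<Delta>:
  assumes "\<And>p. p \<in> P \<Longrightarrow> 0 \<le> w p" and "\<exists>p\<in>P. 0 < w p"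
    and "\<And>p q. \<lbrakk>p \<in> P; q \<in> P; 0 < w p; 0 < w q\<rbrakk> \<Longrightarrow> (p, q) \<notin> inc \<and> ((p, q) \<in> r \<longrightarrow> p = q)"
  shows "normalise w \<in> \<Delta>" and "0 < sum w P"
proof -
  show pos: "0 < sum w P"
    using assms(1,2) finite_P by (metis sum_pos2)
  have "0 < w p" if "p \<in> P" "w p \<noteq> 0" for p using assms(1)[OF that(1)] that by simp
  then show "normalise w \<in> \<Delta>"
    using assms pos unfolding mem_\<Delta>_iff normalise_def
    by (auto simp flip: sum_divide_distrib intro!: divide_nonneg_pos)
qed

lemma continuous_map_normalise:
  assumes "\<And>p. p \<in> P \<Longrightarrow> continuous_map X euclideanreal (\<lambda>x. w x p)"
    and "\<And>x. x \<in> topspace X \<Longrightarrow> 0 < sum (w x) P"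
  shows "continuous_map X (powertop_real P) (\<lambda>x. normalise (w x))"
proof -
  have "continuous_map X euclideanreal (\<lambda>x. w x p / (\<Sum>q\<in>P. w x q))" if "p \<in> P" for p
    using assms finite_P that by (intro continuous_map_real_divide continuous_map_sum) force+
  then show ?thesis
    by (auto simp: continuous_map_componentwise normalise_def)
qed


section \<open>The map from the cubical complex to the crossing complex\<close>

text \<open>The weight \<open>x p * (1 - x p)\<close> vanishes at 0 and 1 and grows as
  \<open>x p\<close> approaches 1/2, so the largest coordinates of the image come from those of
  \<open>x\<close> nearest to 1/2.\<close>

definition to_\<Delta> :: "('a \<Rightarrow> real) \<Rightarrow> 'a \<Rightarrow> real" where
  "to_\<Delta> x = normalise (\<lambda>p. x p * (1 - x p))"

lemma fractional_iff:
  assumes "x \<in> \<K>" "p \<in> P"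
  shows "0 < x p * (1 - x p) \<longleftrightarrow> 0 < x p \<and> x p < 1"
  using \<K>_bounds[OF assms] by (auto simp: zero_less_mult_iff)

lemma to_\<Delta>_in_\<Delta>:
  assumes x: "x \<in> \<K>" and p: "p \<in> P" "0 < x p" "x p < 1"
  shows "to_\<Delta> x \<in> \<Delta>" and "0 < (\<Sum>p\<in>P. x p * (1 - x p))"
proof -
  have "(q, s) \<notin> inc \<and> ((q, s) \<in> r \<longrightarrow> q = s)"
    if "q \<in> P" "s \<in> P" "0 < x q * (1 - x q)" "0 < x s * (1 - x s)" for q s
    using that \<K>_below[OF x, of s q] \<K>_consistent[OF x] by (auto simp: fractional_iff[OF x])
  moreover have "0 \<le> x q * (1 - x q)" if "q \<in> P" for q
    using \<K>_bounds[OF x that] by simp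
  moreover have "\<exists>p\<in>P. 0 < x p * (1 - x p)"
    using p by (intro bexI[of _ p]) simp_all
  ultimately show "to_\<Delta> x \<in> \<Delta>" "0 < (\<Sum>p\<in>P. x p * (1 - x p))"
    unfolding to_\<Delta>_def using normalise_in_\<Delta>[of "\<lambda>p. x p * (1 - x p)"] by auto
qed

lemma to_\<Delta>_nonzero_iff:
  assumes x: "x \<in> \<K>" and p: "p \<in> P" "0 < x p" "x p < 1" and q: "q \<in> P"
  shows "to_\<Delta> x q \<noteq> 0 \<longleftrightarrow> 0 < x q \<and> x q < 1"
  using to_\<Delta>_in_\<Delta>(2)[OF x p] q \<K>_bounds[OF x q] by (auto simp: to_\<Delta>_def normalise_def)


section \<open>The map from the crossing complex to the cubical complex\<close>

text \<open>Counting strict predecessors gives a rank that grows strictly along the order and stays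
  below \<open>card P\<close>; it schedules the order in which coordinates are raised.\<close>

definition height :: "'a \<Rightarrow> nat" where
  "height p = card {q \<in> P. (q, p) \<in> r \<and> q \<noteq> p}"

lemma height_strict_mono:
  assumes "(p, q) \<in> r" "p \<noteq> q"
  shows "height p < height q"
proof -
  \<comment> \<open>The inclusion is proper because of \<open>p\<close> itself; antisymmetry
    excludes \<open>s = q\<close>.\<close>
  have "{s \<in> P. (s, p) \<in> r \<and> s \<noteq> p} \<subset> {s \<in> P. (s, q) \<in> r \<and> s \<noteq> q}"
    using assms r_trans r_antisym r_sub by blast
  then show ?thesis
    unfolding height_def using finite_P by (intro psubset_card_mono) auto
qed

lemma height_less_card:
  assumes "p \<in> P"
  shows "height p < card P"
  unfolding height_def using assms finite_P by (intro psubset_card_mono) auto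

text \<open>The excess of \<open>y\<close> at \<open>p\<close> is positive only if \<open>y p > 1 / (card P + 1)\<close>, and it is at
  least 1 if \<open>y p \<ge> 1 / card P\<close>, which happens for some \<open>p\<close>.\<close>

definition excess :: "('a \<Rightarrow> real) \<Rightarrow> 'a \<Rightarrow> real" where
  "excess y p = real (card P) * (real (card P) + 1) * y p - real (card P)"

lemma excess_large:
  assumes "p \<in> P" "1 / card P \<le> y p"
  shows "1 \<le> excess y p"
proof -
  let ?n = "real (card P)"
  have n: "0 < ?n" using assms finite_P card_gt_0_iff by auto
  then have "?n + 1 = ?n * (?n + 1) * (1 / ?n)" by simp
  also have "\<dots> \<le> ?n * (?n + 1) * y p"
    using n assms(2) by (intro mult_left_mono) auto
  finally show ?thesis unfolding excess_def by linarith
qed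

lemma excess_0: "y p = 0 \<Longrightarrow> excess y p = - real (card P)"
  by (simp add: excess_def)

lemma excess_pos_imp: "0 < excess y p \<Longrightarrow> y p \<noteq> 0"
  using excess_0[of y p] by auto

text \<open>As \<open>y q\<close> grows from 0, the elements below \<open>q\<close> are raised from 0 to 1 one height after the
  other, so that they have all reached 1 before \<open>q\<close> itself starts to be raised.\<close>

definition contribution :: "('a \<Rightarrow> real) \<Rightarrow> 'a \<Rightarrow> 'a \<Rightarrow> real" where
  "contribution y p q =
     (if q = p then max 0 (min (1/2) (excess y p))
      else max 0 (min 1 (excess y q + height q - height p)))"

text \<open>Several \<open>q\<close> may act on the same \<open>p\<close>. The truncated sum is
  continuous, is positive iff some contribution is, and equals 1 as soon as one contribution
  does.\<close>

definition to_\<K> :: "('a \<Rightarrow> real) \<Rightarrow> 'a \<Rightarrow> real" where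
  "to_\<K> y = (\<lambda>p\<in>P. min 1 (\<Sum>q\<in>{q \<in> P. (p, q) \<in> r}. contribution y p q))"

lemma contribution_nonneg: "0 \<le> contribution y p q"
  by (simp add: contribution_def)

text \<open>Where \<open>y q = 0\<close> the excess is \<open>- card P\<close>, which
  \<open>height q < card P\<close> cannot make up for.\<close>

lemma contribution_pos_imp:
  assumes "0 < contribution y p q" "q \<in> P"
  shows "y q \<noteq> 0"
proof
  assume "y q = 0"
  then have "excess y q = - real (card P)" by (rule excess_0)
  moreover have "real (height q) < real (card P)" using height_less_card assms(2) by simp
  ultimately show False using assms(1) by (auto simp: contribution_def split: if_splits)
qed

text \<open>Heights are integers, so a strict step down adds at least 1 to
  \<open>excess y q + height q - height p\<close>, which saturates a contribution that was already
  positive. This includes \<open>q = p\<close>, where the heights cancel.\<close>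

lemma contribution_below:
  assumes "0 < contribution y p q" "(p', p) \<in> r" "p' \<noteq> p" "(p, q) \<in> r"
  shows "contribution y p' q = 1"
proof -
  have "real (height p') + 1 \<le> real (height p)"
    using height_strict_mono[OF assms(2,3)] by linarith
  \<comment> \<open>Thus the cap for \<open>p'\<close> is 1, not the 1/2 of the diagonal
    case.\<close>
  moreover have "q \<noteq> p'" using assms r_antisym by blast
  moreover have "0 < excess y q + height q - height p"
    using assms(1) by (auto simp: contribution_def split: if_splits)
  ultimately show ?thesis by (simp add: contribution_def)
qed

lemma to_\<K>_nonneg: "p \<in> P \<Longrightarrow> 0 \<le> to_\<K> y p"
  by (simp add: to_\<K>_def sum_nonneg contribution_nonneg)

lemma to_\<K>_pos_imp:
  assumes "p \<in> P" "0 < to_\<K> y p"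
  obtains q where "q \<in> P" "(p, q) \<in> r" "0 < contribution y p q"
proof -
  have "(\<Sum>q\<in>{q \<in> P. (p, q) \<in> r}. contribution y p q) \<noteq> 0"
    using assms by (auto simp: to_\<K>_def)
  then obtain q where "q \<in> P" "(p, q) \<in> r" "contribution y p q \<noteq> 0"
    by (rule sum.not_neutral_contains_not_neutral) auto
  then show thesis using that contribution_nonneg[of y p q] by fastforce
qed

text \<open>A positive coordinate at \<open>q\<close> is due to some \<open>s\<close> in the support
  of \<open>y\<close> at or above \<open>q\<close>, and this same \<open>s\<close> saturates
  everything strictly below \<open>q\<close>. An inconsistent pair of positive coordinates would
  propagate upwards to an inconsistent pair in the support.\<close>

lemma to_\<K>_in_\<K>:
  assumes y: "y \<in> \<Delta>"
  shows "to_\<K> y \<in> \<K>"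
  unfolding mem_\<K>_iff
proof (intro conjI ballI impI)
  show "to_\<K> y \<in> P \<rightarrow>\<^sub>E {0..1}"
    by (auto simp: to_\<K>_def sum_nonneg contribution_nonneg)
next
  fix p q assume pq: "p \<in> P" "q \<in> P" "0 < to_\<K> y q" "(p, q) \<in> r" "p \<noteq> q"
  obtain s where s: "s \<in> P" "(q, s) \<in> r" "0 < contribution y q s"
    using to_\<K>_pos_imp pq by blast
  have "(p, s) \<in> r" using r_trans pq s by blast
  moreover have "contribution y p s = 1"
    using contribution_below s pq by blast
  ultimately have "1 \<le> (\<Sum>q\<in>{q \<in> P. (p, q) \<in> r}. contribution y p q)"
    using member_le_sum[of s "{q \<in> P. (p, q) \<in> r}" "contribution y p"] s finite_P contribution_nonneg
    by auto
  then show "to_\<K> y p = 1" using pq by (simp add: to_\<K>_def)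
next
  fix p q assume pq: "p \<in> P" "q \<in> P" "0 < to_\<K> y p" "0 < to_\<K> y q"
  obtain s where s: "s \<in> P" "(p, s) \<in> r" "0 < contribution y p s"
    using to_\<K>_pos_imp pq by blast
  obtain s' where s': "s' \<in> P" "(q, s') \<in> r" "0 < contribution y q s'"
    using to_\<K>_pos_imp pq by blast
  show "(p, q) \<notin> inc"
    using \<Delta>_consistent[OF y] contribution_pos_imp s s' inc_up by blast
qed

text \<open>The support is an antichain, so above \<open>p\<close> it contains only
  \<open>p\<close>, and the diagonal contribution alone survives.\<close>

lemma to_\<K>_on_support:
  assumes y: "y \<in> \<Delta>" and p: "p \<in> P" "y p \<noteq> 0"
  shows "to_\<K> y p = max 0 (min (1/2) (excess y p))"
proof -
  have "contribution y p q = 0" if "q \<in> {q \<in> P. (p, q) \<in> r} - {p}" for q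
    using contribution_pos_imp[of y p q] \<Delta>_antichain[OF y] that p contribution_nonneg[of y p q]
    by fastforce
  then have "(\<Sum>q\<in>{q \<in> P. (p, q) \<in> r}. contribution y p q) = (\<Sum>q\<in>{p}. contribution y p q)"
    using finite_P p r_refl by (intro sum.mono_neutral_right) auto
  then show ?thesis using p by (simp add: to_\<K>_def contribution_def)
qed

lemma to_\<K>_half:
  assumes "y \<in> \<Delta>" "p \<in> P" "1 / card P \<le> y p"
  shows "to_\<K> y p = 1/2"
proof -
  have "1 \<le> excess y p" using excess_large assms by blast
  moreover from this have "y p \<noteq> 0" using excess_pos_imp[of y p] by linarith
  ultimately show ?thesis using to_\<K>_on_support[of y p] assms by simp
qed

lemma continuous_map_excess:
  assumes "q \<in> P"
  shows "continuous_map (subtopology (powertop_real P) A) euclideanreal (\<lambda>y. excess y q)"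
  unfolding excess_def using assms by (intro continuous_intros)

lemma continuous_map_to_\<K>:
  "continuous_map (subtopology (powertop_real P) A) (powertop_real P) to_\<K>"
proof -
  have "continuous_map (subtopology (powertop_real P) A) euclideanreal (\<lambda>y. contribution y p q)"
    if "p \<in> P" "q \<in> P" for p q
    unfolding contribution_def using that
    by (cases "q = p") (auto intro!: continuous_intros continuous_map_excess)
  then have "continuous_map (subtopology (powertop_real P) A) euclideanreal
      (\<lambda>y. min 1 (\<Sum>q\<in>{q \<in> P. (p, q) \<in> r}. contribution y p q))" if "p \<in> P" for p
    using that finite_P by (intro continuous_map_real_min continuous_map_sum) auto
  then show ?thesis
    by (auto simp: continuous_map_componentwise to_\<K>_def)
qed


section \<open>The two maps are homotopy inverse\<close>

text \<open>For \<open>D = {0}\<close> this is the union of the hyperplanes, for \<open>D = {..<1/2}\<close> the complement of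
  the vertices.\<close>

definition near_half :: "real set \<Rightarrow> ('a \<Rightarrow> real) set" where
  "near_half D = {x \<in> \<K>. \<exists>p\<in>P. \<bar>x p - 1/2\<bar> \<in> D}"

text \<open>That \<open>0 \<in> D\<close> admits points with a coordinate 1/2, that \<open>D\<close>
  stays below 1/2 provides a fractional coordinate, and downward closure preserves membership when a
  coordinate moves towards 1/2.\<close>

context
  fixes D :: "real set"
  assumes D0: "0 \<in> D" and D_less: "\<And>d. d \<in> D \<Longrightarrow> d < 1/2"
    and D_down: "\<And>d e. d \<in> D \<Longrightarrow> 0 \<le> e \<Longrightarrow> e \<le> d \<Longrightarrow> e \<in> D"
begin

lemma near_half_fractional:
  assumes "x \<in> near_half D"
  obtains p where "p \<in> P" "0 < x p" "x p < 1"
proof -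
  obtain p where "p \<in> P" "\<bar>x p - 1/2\<bar> \<in> D"
    using assms by (auto simp: near_half_def)
  moreover from this D_less have "\<bar>x p - 1/2\<bar> < 1/2" by blast
  ultimately show thesis using that[of p] by linarith
qed

lemma near_half_\<K>: "x \<in> near_half D \<Longrightarrow> x \<in> \<K>"
  by (simp add: near_half_def)

lemma near_half_to_\<Delta>: "x \<in> near_half D \<Longrightarrow> to_\<Delta> x \<in> \<Delta>"
  using near_half_fractional near_half_\<K> to_\<Delta>_in_\<Delta>(1) by blast

lemma to_\<K>_near_half:
  assumes "y \<in> \<Delta>"
  shows "to_\<K> y \<in> near_half D"
proof -
  obtain p where "p \<in> P" "to_\<K> y p = 1/2"
    using \<Delta>_large_coordinate[OF assms] to_\<K>_half[OF assms] by blast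
  then have "\<exists>p\<in>P. \<bar>to_\<K> y p - 1/2\<bar> \<in> D" 
    using D0 by (metis abs_zero diff_self)
  then show ?thesis using to_\<K>_in_\<K>[OF assms] by (simp add: near_half_def)
qed

text \<open>Take \<open>p\<close> maximising \<open>x p * (1 - x p)\<close>. It is nearest to 1/2,
  hence its distance is in \<open>D\<close>; it also gives a largest coordinate of
  \<open>to_\<Delta> x\<close>, which is at least the average and so is sent to 1/2.\<close>

lemma near_half_common_coordinate:
  assumes x: "x \<in> near_half D"
  obtains p where "p \<in> P" "\<bar>x p - 1/2\<bar> \<in> D" "to_\<K> (to_\<Delta> x) p = 1/2"
proof -
  have y: "to_\<Delta> x \<in> \<Delta>" using near_half_to_\<Delta>[OF x] .
  obtain q where q: "q \<in> P" "\<bar>x q - 1/2\<bar> \<in> D"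
    using x by (auto simp: near_half_def)
  let ?w = "\<lambda>p. x p * (1 - x p)"
  have "Max (?w ` P) \<in> ?w ` P" using q finite_P by (intro Max_in) auto
  then obtain p where p: "p \<in> P" "?w p = Max (?w ` P)" by force
  have max: "?w s \<le> ?w p" if "s \<in> P" for s
    using that finite_P unfolding p(2) by (intro Max_ge) auto
  \<comment> \<open>Because \<open>x p * (1 - x p)\<close> is 1/4 minus the square of
    \<open>x p - 1/2\<close>.\<close>
  have "(x p - 1/2)\<^sup>2 \<le> (x q - 1/2)\<^sup>2"
    using max[OF q(1)] by (simp add: power2_eq_square algebra_simps)
  then have "\<bar>x p - 1/2\<bar> \<le> \<bar>x q - 1/2\<bar>"
    by (simp only: abs_le_square_iff)
  then have "\<bar>x p - 1/2\<bar> \<in> D" using D_down[OF q(2)] by simp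
  moreover have "to_\<K> (to_\<Delta> x) p = 1/2"
  proof (rule to_\<K>_half[OF y p(1)])
    obtain s where s: "s \<in> P" "1 / card P \<le> to_\<Delta> x s"
      using \<Delta>_large_coordinate[OF y] .
    obtain u where "u \<in> P" "0 < x u" "x u < 1" using near_half_fractional[OF x] .
    then have "0 < (\<Sum>p\<in>P. ?w p)"
      using to_\<Delta>_in_\<Delta>(2) near_half_\<K>[OF x] by blast
    then have "to_\<Delta> x s \<le> to_\<Delta> x p"
      using max[OF s(1)] s(1) p(1) by (simp add: to_\<Delta>_def normalise_def divide_right_mono)
    with s show "1 / card P \<le> to_\<Delta> x p" by linarith
  qed
  ultimately show thesis using that p(1) by blast
qed

lemma topspace_near_half: "topspace (subtopology (powertop_real P) (near_half D)) = near_half D"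
proof -
  have "near_half D \<subseteq> topspace (powertop_real P)"
    using near_half_\<K>[THEN \<K>_extensional] by (simp add: subset_iff PiE_iff)
  then show ?thesis by (rule topspace_subtopology_subset)
qed

lemma continuous_map_to_\<Delta>:
  "continuous_map (subtopology (powertop_real P) (near_half D)) (subtopology (powertop_real P) \<Delta>) to_\<Delta>"
proof (rule continuous_map_into_subtopology)
  let ?X = "subtopology (powertop_real P) (near_half D)"
  show "continuous_map ?X (powertop_real P) to_\<Delta>"
    unfolding to_\<Delta>_def
  proof (rule continuous_map_normalise)
    show "continuous_map ?X euclideanreal (\<lambda>x. x p * (1 - x p))" if "p \<in> P" for p
      using that by (intro continuous_intros)
    show "0 < (\<Sum>p\<in>P. x p * (1 - x p))" if "x \<in> topspace ?X" for x
      using that near_half_fractional near_half_\<K> to_\<Delta>_in_\<Delta>(2)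
      unfolding topspace_near_half by metis
  qed
  show "to_\<Delta> \<in> topspace ?X \<rightarrow> \<Delta>"
    using near_half_to_\<Delta> unfolding topspace_near_half by blast
qed

lemma continuous_map_to_near_half:
  "continuous_map (subtopology (powertop_real P) \<Delta>) (subtopology (powertop_real P) (near_half D)) to_\<K>"
  using continuous_map_to_\<K> to_\<K>_near_half by (intro continuous_map_into_subtopology) auto

text \<open>A positive value at \<open>p\<close> would come from a fractional coordinate
  \<open>q\<close> of \<open>x\<close> with \<open>q = p\<close> or \<open>q\<close> above
  \<open>p\<close>; either way \<open>x p\<close> is positive. So the round trip does not enlarge
  the support.\<close>

lemma to_\<K>_to_\<Delta>_eq_0:
  assumes x: "x \<in> near_half D" and p: "p \<in> P" "x p = 0"
  shows "to_\<K> (to_\<Delta> x) p = 0"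
proof (rule ccontr)
  note xK = near_half_\<K>[OF x]
  obtain u where u: "u \<in> P" "0 < x u" "x u < 1" using near_half_fractional[OF x] .
  assume "to_\<K> (to_\<Delta> x) p \<noteq> 0"
  then have "0 < to_\<K> (to_\<Delta> x) p" using to_\<K>_nonneg[OF p(1), of "to_\<Delta> x"] by linarith
  then obtain q where q: "q \<in> P" "(p, q) \<in> r" "0 < contribution (to_\<Delta> x) p q"
    using to_\<K>_pos_imp[OF p(1)] by metis
  then have "0 < x q"
    using to_\<Delta>_nonzero_iff[OF xK u q(1)] contribution_pos_imp[OF q(3,1)] by simp
  then show False using \<K>_below[OF xK _ q(2)] p(2) by (cases "p = q") simp_all
qed

lemma to_\<K>_to_\<Delta>_homotopic_id:
  "homotopic_with (\<lambda>_. True) (subtopology (powertop_real P) (near_half D))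
     (subtopology (powertop_real P) (near_half D)) (to_\<K> \<circ> to_\<Delta>) id"
proof -
  let ?X = "subtopology (powertop_real P) (near_half D)"
  let ?g = "\<lambda>x. to_\<K> (to_\<Delta> x)"
  note topX = topspace_near_half
  have cont_g: "continuous_map ?X (powertop_real P) ?g"
    using continuous_map_compose[OF continuous_map_to_\<Delta> continuous_map_to_near_half]
    by (simp add: o_def continuous_map_in_subtopology)
  \<comment> \<open>Criterion for both legs of the homotopy: by \<open>zero\<close>, consistency is
    inherited from \<open>x\<close>; by \<open>half\<close>, the common coordinate keeps its
    distance from 1/2 within \<open>D\<close>.\<close>
  have mem: "restrict z P \<in> near_half D"
    if x: "x \<in> near_half D"
      and below: "\<And>p q. \<lbrakk>(p, q) \<in> r; p \<noteq> q; 0 < z q\<rbrakk> \<Longrightarrow> z p = 1"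
      and bounds: "\<And>p. p \<in> P \<Longrightarrow> 0 \<le> z p \<and> z p \<le> 1"
      and zero: "\<And>p. p \<in> P \<Longrightarrow> x p = 0 \<Longrightarrow> z p = 0"
      and half: "\<And>p. p \<in> P \<Longrightarrow> ?g x p = 1/2 \<Longrightarrow> \<bar>z p - 1/2\<bar> \<le> \<bar>x p - 1/2\<bar>"
    for x z
  proof -
    note xK = near_half_\<K>[OF x]
    obtain p where "p \<in> P" "\<bar>x p - 1/2\<bar> \<in> D" "?g x p = 1/2"
      using near_half_common_coordinate[OF x] .
    then have "\<exists>p\<in>P. \<bar>z p - 1/2\<bar> \<in> D" using half D_down abs_ge_zero by blast
    moreover have "0 < x p" if "p \<in> P" "0 < z p" for p
      using zero[OF that(1)] \<K>_bounds[OF xK that(1)] that by (cases "x p = 0") auto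
    then have "(p, q) \<notin> inc" if "p \<in> P" "q \<in> P" "0 < z p" "0 < z q" for p q
      using \<K>_consistent[OF xK] that by blast
    then have "restrict z P \<in> \<K>"
      unfolding mem_\<K>_iff using bounds below by simp
    ultimately show ?thesis by (simp add: near_half_def)
  qed
  let ?m = "\<lambda>x. \<lambda>p\<in>P. max (?g x p) (x p)"
  have m: "continuous_map ?X (powertop_real P) ?m"
  proof -
    have "continuous_map ?X euclideanreal (\<lambda>x. ?g x p)" if "p \<in> P" for p
      using cont_g that by (auto simp: continuous_map_componentwise)
    then show ?thesis
      by (auto simp: continuous_map_componentwise intro!: continuous_intros)
  qed
  have facts: "?g x \<in> \<K>" "x \<in> \<K>" if "x \<in> near_half D" for x
    using that near_half_\<K> near_half_to_\<Delta> to_\<K>_in_\<K> by auto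
  \<comment> \<open>A straight segment could make a coordinate positive before those below it reach
    1; hence the bound that rises with \<open>t\<close> and is delayed by the height.\<close>
  have "homotopic_with (\<lambda>_. True) ?X ?X ?g ?m"
  proof (rule homotopic_with_componentwise
      [where h = "\<lambda>t x p. max (?g x p) (min (x p) (real (card P) * t - real (height p)))"])
    fix p assume p: "p \<in> P"
    have "continuous_map ?X (powertop_real P) (\<lambda>x. x)" by simp
    from continuous_map_snd_coordinate[OF this p] continuous_map_snd_coordinate[OF cont_g p]
    show "continuous_map (prod_topology (top_of_set {0..1}) ?X) euclideanreal
        (\<lambda>z. max (?g (snd z) p) (min (snd z p) (real (card P) * fst z - real (height p))))"
      by (intro continuous_map_real_max continuous_map_real_min continuous_map_diff
          continuous_map_real_mult continuous_map_canonical_const continuous_map_fst_real)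
  next
    fix t :: real and x assume "x \<in> topspace ?X" and t: "0 \<le> t" "t \<le> 1"
    then have x: "x \<in> near_half D" by (simp only: topX)
    note K = facts[OF x]
    let ?z = "\<lambda>p. max (?g x p) (min (x p) (real (card P) * t - real (height p)))"
    show "restrict ?z P \<in> near_half D"
    proof (rule mem[OF x])
      fix p q assume pq: "(p, q) \<in> r" "p \<noteq> q" "0 < ?z q"
      then have "p \<in> P" using r_sub by blast
      note bounds = \<K>_bounds[OF K(1) this] \<K>_bounds[OF K(2) this]
      show "?z p = 1"
      proof (cases "0 < ?g x q")
        case True
        then show ?thesis using \<K>_below[OF K(1) _ pq(1,2)] bounds by auto
      next
        case False
        \<comment> \<open>Once the bound for \<open>q\<close> is positive, the bound for the lower
          \<open>p\<close> exceeds 1, so \<open>p\<close> has already reached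
          \<open>x p = 1\<close>.\<close>
        then have "0 < x q" "0 < real (card P) * t - real (height q)" using pq(3) by auto
        moreover have "real (height p) + 1 \<le> real (height q)"
          using height_strict_mono[OF pq(1,2)] by linarith
        ultimately show ?thesis using \<K>_below[OF K(2) _ pq(1,2)] bounds by auto
      qed
    next
      fix p assume p: "p \<in> P"
      note bounds = \<K>_bounds[OF K(1) p] \<K>_bounds[OF K(2) p]
      show "0 \<le> ?z p \<and> ?z p \<le> 1" using bounds by auto
      show "?z p = 0" if "x p = 0" using to_\<K>_to_\<Delta>_eq_0[OF x p that] that by auto
      \<comment> \<open>Here the value lies between 1/2 and \<open>max (1/2) (x p)\<close>.\<close>
      show "\<bar>?z p - 1/2\<bar> \<le> \<bar>x p - 1/2\<bar>" if "?g x p = 1/2"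
        unfolding that by linarith
    qed
  next
    fix x assume "x \<in> topspace ?X"
    then have x: "x \<in> near_half D" by (simp only: topX)
    note K = facts[OF x]
    \<comment> \<open>At time 0 the bound is at most 0, and \<open>?g x p\<close> is
      nonnegative.\<close>
    have "max (?g x p) (min (x p) (real (card P) * 0 - real (height p))) = ?g x p" if "p \<in> P" for p
      using \<K>_bounds[OF K(1) that] by auto
    then show "(\<lambda>p\<in>P. max (?g x p) (min (x p) (real (card P) * 0 - real (height p)))) = ?g x"
      using \<K>_extensional[OF K(1)] by (auto simp: fun_eq_iff extensional_def)
    \<comment> \<open>At time 1 the bound is at least 1, as
      \<open>height p < card P\<close>.\<close>
    have "min (x p) (real (card P) * 1 - real (height p)) = x p" if "p \<in> P" for p
      using \<K>_bounds[OF K(2) that] height_less_card[OF that] by auto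
    then show "(\<lambda>p\<in>P. max (?g x p) (min (x p) (real (card P) * 1 - real (height p)))) = ?m x"
      by auto
  qed
  moreover have "homotopic_with (\<lambda>_. True) ?X ?X ?m id"
  proof (rule homotopic_with_segments[OF m])
    fix t :: real and x assume "x \<in> topspace ?X" and t: "0 \<le> t" "t \<le> 1"
    then have x: "x \<in> near_half D" by (simp only: topX)
    note K = facts[OF x]
    let ?z = "\<lambda>p. (1 - t) * ?m x p + t * id x p"
    show "(\<lambda>p\<in>P. ?z p) \<in> near_half D"
    proof (rule mem[OF x])
      fix p assume p: "p \<in> P"
      note bounds = \<K>_bounds[OF K(1) p] \<K>_bounds[OF K(2) p]
      show "0 \<le> ?z p \<and> ?z p \<le> 1"
        using bounds p t convex_bound_le[of "max (?g x p) (x p)" 1 "x p" "1 - t" t] by auto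
      show "?z p = 0" if "x p = 0" using to_\<K>_to_\<Delta>_eq_0[OF x p that] that p by auto
      show "\<bar>?z p - 1/2\<bar> \<le> \<bar>x p - 1/2\<bar>" if "?g x p = 1/2"
      proof -
        have "?z p - 1/2 = (1 - t) * (max (1/2) (x p) - 1/2) + t * (x p - 1/2)"
          using p by (simp add: that field_simps)
        also have "\<bar>\<dots>\<bar> \<le> (1 - t) * \<bar>max (1/2) (x p) - 1/2\<bar> + t * \<bar>x p - 1/2\<bar>"
          using t by (metis abs_mult abs_of_nonneg abs_triangle_ineq diff_ge_0_iff_ge)
        also have "\<dots> \<le> (1 - t) * \<bar>x p - 1/2\<bar> + t * \<bar>x p - 1/2\<bar>"
          using t by (intro add_mono mult_left_mono) auto
        finally show ?thesis by (simp add: algebra_simps)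
      qed
    next
      fix p q assume pq: "(p, q) \<in> r" "p \<noteq> q" "0 < ?z q"
      then have P: "p \<in> P" "q \<in> P" using r_sub by auto
      \<comment> \<open>The support of the whole segment lies in that of \<open>x\<close>, so below
        \<open>q\<close> both ends of the segment are already 1.\<close>
      have "0 < x q"
      proof (rule ccontr)
        assume "\<not> 0 < x q"
        then have "x q = 0" using \<K>_bounds[OF K(2) P(2)] by auto
        then show False using pq(3) to_\<K>_to_\<Delta>_eq_0[OF x P(2)] P by simp
      qed
      then have "x p = 1" using \<K>_below[OF K(2)] pq by blast
      then show "?z p = 1" using P \<K>_bounds[OF K(1) P(1)] by auto
    qed
  qed simp
  ultimately show ?thesis
    unfolding o_def by (rule homotopic_with_trans)
qed

text \<open>The composite may have support strictly below elements of the support of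
  \<open>y\<close>, so a direct segment may leave the complex. The support of the intermediate point
  \<open>?s y\<close> is contained in both supports.\<close>

lemma to_\<Delta>_to_\<K>_homotopic_id:
  "homotopic_with (\<lambda>_. True) (subtopology (powertop_real P) \<Delta>)
     (subtopology (powertop_real P) \<Delta>) (to_\<Delta> \<circ> to_\<K>) id"
proof -
  let ?X = "subtopology (powertop_real P) \<Delta>"
  let ?f = "\<lambda>y. to_\<Delta> (to_\<K> y)" and ?s = "\<lambda>y. normalise (\<lambda>p. max 0 (excess y p))"
  have topX: "topspace ?X = \<Delta>"
    by (auto simp: mem_\<Delta>_iff)
  have s: "?s y \<in> \<Delta>" "0 < (\<Sum>p\<in>P. max 0 (excess y p))" if y: "y \<in> \<Delta>" for y
  proof -
    obtain p where "p \<in> P" "1 / card P \<le> y p" using \<Delta>_large_coordinate[OF y] .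
    then have "\<exists>p\<in>P. 0 < max 0 (excess y p)"
      using excess_large[of p y] by (intro bexI[of _ p]) simp_all
    moreover have "(p, q) \<notin> inc \<and> ((p, q) \<in> r \<longrightarrow> p = q)"
      if "p \<in> P" "q \<in> P" "0 < max 0 (excess y p)" "0 < max 0 (excess y q)" for p q
      using that excess_pos_imp \<Delta>_consistent[OF y] \<Delta>_antichain[OF y] by fastforce
    ultimately show "?s y \<in> \<Delta>" "0 < (\<Sum>p\<in>P. max 0 (excess y p))"
      using normalise_in_\<Delta>[of "\<lambda>p. max 0 (excess y p)"] by auto
  qed
  have s_nonzero: "0 < excess y p" if "p \<in> P" "?s y p \<noteq> 0" for y p
    using that by (auto simp: normalise_def max_def split: if_splits)
  have f: "?f y \<in> \<Delta>" if "y \<in> \<Delta>" for y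
    using near_half_to_\<Delta> to_\<K>_near_half that by blast
  have f_nonzero: "?f y p \<noteq> 0" if y: "y \<in> \<Delta>" and p: "p \<in> P" "?s y p \<noteq> 0" for y p
  proof -
    have "0 < excess y p" using s_nonzero p .
    \<comment> \<open>On the support the value is the excess capped at 1/2, hence fractional when
      the excess is positive.\<close>
    then have "0 < to_\<K> y p" "to_\<K> y p < 1"
      using to_\<K>_on_support[OF y p(1)] excess_pos_imp[of y p] by auto
    then show ?thesis using to_\<Delta>_nonzero_iff to_\<K>_in_\<K>[OF y] p(1) by blast
  qed
  have cont_f: "continuous_map ?X (powertop_real P) ?f"
    using continuous_map_compose[OF continuous_map_to_near_half continuous_map_to_\<Delta>]
    by (simp add: o_def continuous_map_in_subtopology)
  have cont_s: "continuous_map ?X (powertop_real P) ?s"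
  proof (rule continuous_map_normalise)
    show "continuous_map ?X euclideanreal (\<lambda>y. max 0 (excess y p))" if "p \<in> P" for p
      by (intro continuous_map_real_max continuous_map_canonical_const continuous_map_excess that)
    show "0 < (\<Sum>p\<in>P. max 0 (excess y p))" if "y \<in> topspace ?X" for y
      using s(2) that unfolding topX .
  qed
  have "homotopic_with (\<lambda>_. True) ?X ?X ?f ?s"
  proof (rule homotopic_with_segments[OF cont_f cont_s])
    fix t :: real and y assume "y \<in> topspace ?X" and t: "0 \<le> t" "t \<le> 1"
    then have y: "y \<in> \<Delta>" by (simp only: topX)
    show "(\<lambda>p\<in>P. (1 - t) * ?f y p + t * ?s y p) \<in> \<Delta>"
      by (rule \<Delta>_segment(2)[OF s(1)[OF y] f[OF y] t f_nonzero[OF y]])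
  qed
  moreover have "homotopic_with (\<lambda>_. True) ?X ?X ?s id"
  proof (rule homotopic_with_segments[OF cont_s])
    fix t :: real and y assume "y \<in> topspace ?X" and t: "0 \<le> t" "t \<le> 1"
    then have y: "y \<in> \<Delta>" by (simp only: topX)
    show "(\<lambda>p\<in>P. (1 - t) * ?s y p + t * id y p) \<in> \<Delta>"
      using \<Delta>_segment(1)[OF s(1)[OF y] y t] s_nonzero excess_pos_imp unfolding id_apply by blast
  qed simp
  ultimately show ?thesis
    unfolding o_def by (rule homotopic_with_trans)
qed

lemma homotopy_equivalent_near_half:
  "subtopology (powertop_real P) \<Delta> homotopy_equivalent_space subtopology (powertop_real P) (near_half D)"
  unfolding homotopy_equivalent_space_def
  using continuous_map_to_near_half continuous_map_to_\<Delta>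
    to_\<Delta>_to_\<K>_homotopic_id to_\<K>_to_\<Delta>_homotopic_id by blast

end

section \<open>The union of the hyperplanes and the complement of the vertices\<close>

lemma Union_hyperplanes: "\<Union>(hyperplanes P r inc) = near_half {0}"
proof -
  \<comment> \<open>The equivalence classes cover all midplanes.\<close>
  have "\<Union>(hyperplanes P r inc) = \<Union>(midplanes P r inc)"
    unfolding hyperplanes_def using Union_quotient[OF equiv_midplane_adj, of P r inc] by blast
  also have "\<dots> = {x \<in> \<K>. \<exists>p\<in>P. x p = 1/2}"
  proof (intro equalityI subsetI)
    fix x assume "x \<in> \<Union>(midplanes P r inc)"
    then obtain I M p where x: "(I, M) \<in> cubical_faces P r inc" "p \<in> M" "x \<in> cube P I M" "x p = 1/2"
      unfolding midplanes_def by blast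
    then have "p \<in> P"
      by (auto simp: cubical_faces_def cubical_vertices_def downset_def max_elems_def)
    then show "x \<in> {x \<in> \<K>. \<exists>p\<in>P. x p = 1/2}"
      using x by (auto simp: cubical_realisation_def)
  next
    fix x assume "x \<in> {x \<in> \<K>. \<exists>p\<in>P. x p = 1/2}"
    then obtain p I M where x: "p \<in> P" "x p = 1/2" "(I, M) \<in> cubical_faces P r inc" "x \<in> cube P I M"
      unfolding cubical_realisation_def by blast
    \<comment> \<open>Coordinates outside \<open>M\<close> are 0 or 1.\<close>
    then have "p \<in> M"
      by (cases "p \<in> M") (auto simp: cube_def vertex_point_def indicator_def of_bool_def split: if_splits)
    then show "x \<in> \<Union>(midplanes P r inc)"
      using x unfolding midplanes_def by blast
  qed
  finally show ?thesis by (simp add: near_half_def)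
qed

text \<open>Within \<open>[0,1]\<close>, a distance less than 1/2 from 1/2 means being fractional. A
  point of the complex without fractional coordinates is the indicator of its support, which is a
  consistent downset.\<close>

lemma non_vertices: "\<K> - vertex_point P ` cubical_vertices P r inc = near_half {..<1/2}"
proof -
  have "x \<in> vertex_point P ` cubical_vertices P r inc \<longleftrightarrow> (\<forall>p\<in>P. \<not> \<bar>x p - 1/2\<bar> < 1/2)"
    if x: "x \<in> \<K>" for x
  proof
    show "\<forall>p\<in>P. \<not> \<bar>x p - 1/2\<bar> < 1/2" if "x \<in> vertex_point P ` cubical_vertices P r inc"
      using that by (auto simp: vertex_point_def indicator_def split: split_of_bool_asm)
  next
    assume "\<forall>p\<in>P. \<not> \<bar>x p - 1/2\<bar> < 1/2"
    then have "\<not> \<bar>x p - 1/2\<bar> < 1/2" if "p \<in> P" for p using that by blast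
    then have x01: "x p = 0 \<or> x p = 1" if "p \<in> P" for p
      using \<K>_bounds[OF x that] that by (smt (verit) field_sum_of_halves)
    let ?I = "{p \<in> P. 0 < x p}"
    have "y \<in> ?I" if "p \<in> ?I" "y \<in> P" "(y, p) \<in> r" for p y
      using \<K>_below[OF x, of p y] that by (cases "y = p") auto
    then have "downset P r ?I" unfolding downset_def by blast
    moreover have "consistent inc ?I"
      using \<K>_consistent[OF x] by (auto simp: consistent_def)
    moreover have "x = vertex_point P ?I"
      using x01 \<K>_extensional[OF x]
      by (force simp: vertex_point_def indicator_def fun_eq_iff extensional_def)
    ultimately show "x \<in> vertex_point P ` cubical_vertices P r inc"
      unfolding cubical_vertices_def by blast
  qed
  then show ?thesis by (auto simp: near_half_def)
qed

end

theorem theorem6p3: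
  fixes P :: "'a set" and r inc :: "'a rel"
  assumes "pip P r inc"
  shows "simplicial_space P (crossing_complex P r inc) homotopy_equivalent_space
           subtopology (cubical_space P r inc) (\<Union>(hyperplanes P r inc)) \<and>
         subtopology (cubical_space P r inc) (\<Union>(hyperplanes P r inc)) homotopy_equivalent_space
           subtopology (cubical_space P r inc)
             (cubical_realisation P r inc - vertex_point P ` cubical_vertices P r inc) \<and>
         simplicial_space P (crossing_complex P r inc) homotopy_equivalent_space
           subtopology (cubical_space P r inc)
             (cubical_realisation P r inc - vertex_point P ` cubical_vertices P r inc)"
proof -
  interpret inconsistent_pairs P r inc by unfold_locales (rule assms)
  let ?S = "\<lambda>D. subtopology (cubical_space P r inc) (near_half D)"
  have S: "?S D = subtopology (powertop_real P) (near_half D)" for D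
  proof -
    have "\<K> \<inter> near_half D = near_half D" by (auto simp: near_half_def)
    then show ?thesis by (simp add: cubical_space_def subtopology_subtopology)
  qed
  \<comment> \<open>Both \<open>{0}\<close> and \<open>{..<1/2}\<close> contain 0, lie below 1/2 and
    are closed under passing to smaller nonnegative numbers.\<close>
  have "simplicial_space P (crossing_complex P r inc) homotopy_equivalent_space ?S {0}"
    unfolding S simplicial_space_def by (rule homotopy_equivalent_near_half) auto
  moreover have "simplicial_space P (crossing_complex P r inc) homotopy_equivalent_space ?S {..<1/2}"
    unfolding S simplicial_space_def by (rule homotopy_equivalent_near_half) auto
  ultimately show ?thesis
    unfolding Union_hyperplanes non_vertices
    using homotopy_equivalent_space_sym homotopy_eqv_trans by blast
qed

end
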